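(* Consider the linear Gaussian state space system $X_n=A_nX_{n-1}+Q_n^{1/2}W_n$, $Y_n=H_nX_n+R_n^{1/2}V_n$ ($n\ge1$) described in the context, with initial density $p(x_0)=n(x_0;m_0,P_0)$. Let $q^2>0$, let $y_1,y_2,\ldots\in\mathbb{R}^{d_Y}$ be an arbitrary observation sequence, and assume that at every time $n$ the true data generating density $\pi_n$ of the observation satisfies the regularity conditions (stated in the context). Then the diffusion score matching filtering equations (stated in the context) can be evaluated in closed form and the resulting distributions are Gaussian for every $n\ge1$: $$p(x_n|y_{1:(n-1)})=n(x_n;m_n^f,P_n^f),\quad p(y_n|y_{1:(n-1)})=n(y_n;H_nm_n^f,\Sigma_n),\quad p_{\mathrm{DSM}}(x_n|y_{1:n})=n(x_n;m_n^a,P_n^a),$$ with parameters given by the recursion started from $m_0^a=m_0$, $P_0^a=P_0$: Forecast: $P_n^f=A_nP_{n-1}^aA_n^T+Q_n$ and $m_n^f=A_nm_{n-1}^a$. Analysis: $$\Sigma_n=H_nP_n^fH_n^T+R_n,\qquad k_n(y)=\left(1+\frac{\|y-H_nm_n^f\|^2_{\Sigma_n^{-1}}}{q^2}\right)^{-1/2},\qquad N_n(y_n)=\frac{1}{2k_n^2(y_n)}R_n,$$ $$\tilde y_n=y_n-2N_n(y_n)\nabla_{y_n}k_n^2(y_n),\qquad \widetilde K_n(y_n)=P_n^fH_n^T\left[N_n(y_n)+H_nP_n^fH_n^T\right]^{-1},$$ $$P_n^a=P_n^f-\widetilde K_n(y_n)H_nP_n^f,\qquad m_n^a=m_n^f-\widetilde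 K_n(y_n)\left[H_nm_n^f-\tilde y_n\right].$$
   Context: $n(x;m,P)$ denotes the density of the multivariate Gaussian distribution with mean $m$ and covariance $P$; $\|v\|^2_{\Sigma^{-1}}=v^T\Sigma^{-1}v$. System: $X_n$ is $\mathbb{R}^{d_X}$-valued, $Y_n$ is $\mathbb{R}^{d_Y}$-valued, $W_n$ and $V_n$ are independent standard Gaussian vectors in $\mathbb{R}^{d_X}$ and $\mathbb{R}^{d_Y}$, $A_n\in\mathbb{R}^{d_X\times d_X}$, $H_n\in\mathbb{R}^{d_Y\times d_X}$, $Q_n$ and $R_n$ are symmetric positive definite, and $P_0$ is a covariance matrix. Thus $p(x_n|x_{n-1})=n(x_n;A_nx_{n-1},Q_n)$ and $p(y_n|x_n)=n(y_n;H_nx_n,R_n)$. Diffusion score matching filtering equations: $p_{\mathrm{DSM}}(x_0)=p(x_0)$ and, recursively for $n\ge1$, $$p(x_n|y_{1:(n-1)})=\int p(x_n|x_{n-1})\,p_{\mathrm{DSM}}(x_{n-1}|y_{1:(n-1)})\,\mathrm{d}x_{n-1},$$ $$p(y_n|y_{1:(n-1)})=\int p(y_n|x_n)\,p(x_n|y_{1:(n-1)})\,\mathrm{d}x_n,$$ $$p_{\mathrm{DSM}}(x_n|y_{1:n})\propto p(x_n|y_{1:(n-1)})\exp\left[-\widehat{\mathrm{DSM}}_n(x_n,y_n)\right],$$ where, with $s_{p(\cdot|x)}(y)=\nabla_y\log p(y|x)$ for $p(\cdot|x)=n(\cdot;H_nx,R_n)$ and diffusion matrix $w_n(y)=k_n(y)R_n^{1/2}$,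 $$\widehat{\mathrm{DSM}}_n(x,y)=\left\|w_n^T(y)s_{p(\cdot|x)}(y)\right\|_2^2+2\nabla_y\cdot\left(w_n(y)w_n^T(y)s_{p(\cdot|x)}(y)\right).$$ Regularity conditions on $\pi_n$: for every $x$, $\int\pi_n(y)\|s_{p(\cdot|x)}(y)-\nabla_y\log\pi_n(y)\|^2\,\mathrm{d}y<\infty$, and both $\pi_n w_nw_n^Ts_{p(\cdot|x)}$ and $\nabla\cdot(\pi_n w_nw_n^Ts_{p(\cdot|x)})$ belong to $L^1(\mathbb{R}^{d_Y})$. *)

theory Defs
  imports "HOL-Probability.Probability"
begin

definition sym_psd :: "real^'n^'n \<Rightarrow> bool" where
  "sym_psd S \<longleftrightarrow> transpose S = S \<and> (\<forall>v. 0 \<le> v \<bullet> (S *v v))"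

definition sym_pd :: "real^'n^'n \<Rightarrow> bool" where
  "sym_pd S \<longleftrightarrow> transpose S = S \<and> (\<forall>v. v \<noteq> 0 \<longrightarrow> 0 < v \<bullet> (S *v v))"

text \<open>The principal square root; for positive semidefinite \<open>S\<close> the chosen matrix is unique.\<close>

definition matrix_sqrt :: "real^'n^'n \<Rightarrow> real^'n^'n" where
  "matrix_sqrt S = (SOME B. sym_psd B \<and> B ** B = S)"

definition weighted_norm_sq :: "real^'n^'n \<Rightarrow> real^'n \<Rightarrow> real" where
  "weighted_norm_sq B v = v \<bullet> (B *v v)"

text \<open>\<open>gauss_density m P x\<close> is \<open>n(x; m, P)\<close>; it is a probability density when \<open>P\<close> is
  symmetric positive definite.\<close>

definition gauss_density :: "real^'n \<Rightarrow> real^'n^'n \<Rightarrow> real^'n \<Rightarrow> real" where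
  "gauss_density m P x =
     exp (- weighted_norm_sq (matrix_inv P) (x - m) / 2) / sqrt ((2 * pi) ^ CARD('n) * det P)"

definition grad :: "(real^'n \<Rightarrow> real) \<Rightarrow> real^'n \<Rightarrow> real^'n" where
  "grad f y = (THE D. GDERIV f y :> D)"

definition divergence :: "(real^'n \<Rightarrow> real^'n) \<Rightarrow> real^'n \<Rightarrow> real" where
  "divergence F y = trace (jacobian F (at y))"

text \<open>The noises have values in different types, so independence of the family consisting of
  \<open>X 0\<close>, all \<open>W n\<close> and all \<open>V n\<close> (\<open>n \<ge> 1\<close>) is expressed through the generated
  \<open>\<sigma>\<close>-algebras, indexed by \<open>Inl 0\<close>, \<open>Inl n\<close> and \<open>Inr n\<close>.\<close>

definition linear_gaussian_system ::
  "'w measure \<Rightarrow> (nat \<Rightarrow> 'w \<Rightarrow> real^'x) \<Rightarrow> (nat \<Rightarrow> 'w \<Rightarrow> real^'y) \<Rightarrow>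
   (nat \<Rightarrow> 'w \<Rightarrow> real^'x) \<Rightarrow> (nat \<Rightarrow> 'w \<Rightarrow> real^'y) \<Rightarrow>
   (nat \<Rightarrow> real^'x^'x) \<Rightarrow> (nat \<Rightarrow> real^'x^'y) \<Rightarrow> (nat \<Rightarrow> real^'x^'x) \<Rightarrow> (nat \<Rightarrow> real^'y^'y) \<Rightarrow>
   real^'x \<Rightarrow> real^'x^'x \<Rightarrow> bool" where
  "linear_gaussian_system M X Y W V A H Q R m0 P0 \<longleftrightarrow>
     prob_space M \<and>
     distributed M lborel (X 0) (\<lambda>x. ennreal (gauss_density m0 P0 x)) \<and>
     (\<forall>n\<ge>1. distributed M lborel (W n) (\<lambda>x. ennreal (gauss_density 0 (mat 1) x))) \<and>
     (\<forall>n\<ge>1. distributed M lborel (V n) (\<lambda>y. ennreal (gauss_density 0 (mat 1) y))) \<and>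
     prob_space.indep_sets M
       (\<lambda>i. case i of
              Inl n \<Rightarrow> sets (vimage_algebra (space M) (if n = 0 then X 0 else W n) borel)
            | Inr n \<Rightarrow> sets (vimage_algebra (space M) (V n) borel))
       ((UNIV :: nat set) <+> {1::nat..}) \<and>
     (\<forall>n\<ge>1. \<forall>\<omega>\<in>space M.
        X n \<omega> = A n *v X (n - 1) \<omega> + matrix_sqrt (Q n) *v W n \<omega> \<and>
        Y n \<omega> = H n *v X n \<omega> + matrix_sqrt (R n) *v V n \<omega>)"

text \<open>The score, in the observation variable, of the likelihood \<open>p(\<cdot>|x) = n(\<cdot>; H x, R)\<close>.\<close>

definition lik_score :: "real^'x^'y \<Rightarrow> real^'y^'y \<Rightarrow> real^'x \<Rightarrow> real^'y \<Rightarrow> real^'y" where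
  "lik_score H R x y = grad (\<lambda>z. ln (gauss_density (H *v x) R z)) y"

definition dsm_loss ::
  "(real^'y \<Rightarrow> real^'y^'y) \<Rightarrow> (real^'x \<Rightarrow> real^'y \<Rightarrow> real^'y) \<Rightarrow> real^'x \<Rightarrow> real^'y \<Rightarrow> real" where
  "dsm_loss w s x y =
     (norm (transpose (w y) *v s x y))\<^sup>2
     + 2 * divergence (\<lambda>z. (w z ** transpose (w z)) *v s x z) y"

definition prob_density :: "(real^'y \<Rightarrow> real) \<Rightarrow> bool" where
  "prob_density p \<longleftrightarrow> p \<in> borel_measurable lborel \<and> (\<forall>y. 0 \<le> p y) \<and>
     (\<integral>\<^sup>+ y. ennreal (p y) \<partial>lborel) = 1"

text \<open>Almost everywhere differentiability of \<open>p\<close> is the least that gives the two derivatives of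
  \<open>p\<close> below a meaning as integrands; where \<open>p\<close> vanishes, the first integrand is \<open>0\<close>.\<close>

definition dsm_regular ::
  "(real^'y \<Rightarrow> real) \<Rightarrow> (real^'y \<Rightarrow> real^'y^'y) \<Rightarrow> (real^'x \<Rightarrow> real^'y \<Rightarrow> real^'y) \<Rightarrow> bool" where
  "dsm_regular p w s \<longleftrightarrow>
     (AE y in lborel. p differentiable (at y)) \<and>
     (\<forall>x. integrable lebesgue (\<lambda>y. p y * (norm (s x y - grad (\<lambda>z. ln (p z)) y))\<^sup>2) \<and>
          integrable lebesgue (\<lambda>y. p y *\<^sub>R ((w y ** transpose (w y)) *v s x y)) \<and>
          integrable lebesgue
            (\<lambda>y. divergence (\<lambda>z. p z *\<^sub>R ((w z ** transpose (w z)) *v s x z)) y))"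

end

theory Submission
  imports Defs
begin

text \<open>For a Gaussian likelihood and the diffusion matrix \<open>k R\<^sup>1\<^sup>/\<^sup>2\<close> the score matching loss is
  quadratic in the state. Completing the square identifies \<open>exp (- loss)\<close>, up to a factor
  independent of the state, with the Gaussian likelihood of the pseudo-observation
  \<open>y - 2 N \<nabla>k\<^sup>2\<close> under noise covariance \<open>N = R / (2 k\<^sup>2)\<close>. Every filtering step is then an instance
  of the factorization of a Gaussian likelihood times a Gaussian prior into evidence times
  posterior. The exponents agree by the Woodbury identity; the normalizing constants agree because
  both sides integrate to \<open>1\<close> over the joint space, so no determinant identity is needed.\<close>

section \<open>Symmetric matrices\<close>

definition diag_matrix :: "('n \<Rightarrow> real) \<Rightarrow> real^'n^'n" where
  "diag_matrix d = (\<chi> i j. if i = j then d i else 0)"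

lemma diag_matrix_mult_vector: "(diag_matrix d *v x) $ i = d i * x $ i"
  by (simp add: diag_matrix_def matrix_vector_mult_def if_distrib if_distribR cong: if_cong)

lemma diag_matrix_mult: "diag_matrix c ** diag_matrix d = diag_matrix (\<lambda>i. c i * d i)"
  by (simp add: matrix_eq vec_eq_iff diag_matrix_mult_vector flip: matrix_vector_mul_assoc)

lemma transpose_diag_matrix [simp]: "transpose (diag_matrix d) = diag_matrix d"
  by (auto simp: diag_matrix_def transpose_def vec_eq_iff)

lemma diag_matrix_one: "diag_matrix (\<lambda>i. 1) = mat 1"
  by (auto simp: diag_matrix_def mat_def vec_eq_iff)

lemma det_diag_matrix: "det (diag_matrix d) = (\<Prod>i\<in>UNIV. d i)"
  by (subst det_diagonal) (auto simp: diag_matrix_def)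

lemma inner_matrix_vector_transpose:
  fixes B :: "real^'n^'m"
  shows "x \<bullet> (B *v y) = (transpose B *v x) \<bullet> y"
  by (simp add: dot_lmul_matrix)

section \<open>Spectral theorem for real symmetric matrices\<close>

text \<open>A maximizer of the quadratic form on the unit sphere of \<open>V\<close> is an
  eigenvector: its residual stays in \<open>V\<close> by invariance, and a nonzero residual would be
  a direction of first-order increase. Working inside an invariant subspace lets eigenvectors be
  collected one after another.\<close>

lemma rayleigh_eigenvector:
  fixes S :: "real^'n^'n"
  assumes sym: "transpose S = S" and V: "subspace V" and inv: "\<And>x. x \<in> V \<Longrightarrow> S *v x \<in> V"
    and ne: "x0 \<in> V" "x0 \<noteq> 0"
  obtains v l where "v \<in> V" "norm v = 1" "S *v v = l *\<^sub>R v"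
proof -
  let ?T = "sphere 0 1 \<inter> V"
  have "compact ?T"
    by (intro compact_Int_closed closed_subspace V compact_sphere)
  moreover have "(1 / norm x0) *\<^sub>R x0 \<in> ?T"
    using ne V by (auto intro: subspace_scale)
  moreover have "continuous_on ?T (\<lambda>x. x \<bullet> (S *v x))"
    by (intro continuous_intros matrix_vector_mult_linear_continuous_on)
  ultimately obtain v where v: "v \<in> ?T" and max: "\<And>x. x \<in> ?T \<Longrightarrow> x \<bullet> (S *v x) \<le> v \<bullet> (S *v v)"
    using continuous_attains_sup[of ?T "\<lambda>x. x \<bullet> (S *v x)"] by blast
  define l where "l = v \<bullet> (S *v v)"
  \<comment> \<open>The form is homogeneous of degree 2, so the maximum over the sphere bounds it on
    all of \<open>V\<close>.\<close>
  have bound: "x \<bullet> (S *v x) \<le> l * (x \<bullet> x)" if "x \<in> V" for x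
  proof (cases "x = 0")
    case False
    have "(1 / norm x) *\<^sub>R x \<in> ?T"
      using False V that by (auto intro: subspace_scale)
    from max[OF this] have "(x \<bullet> (S *v x)) / (norm x)\<^sup>2 \<le> l"
      by (simp add: l_def matrix_vector_mult_scaleR power2_eq_square field_simps)
    then show ?thesis
      using False by (simp add: field_simps power2_norm_eq_inner)
  qed simp
  define u where "u = S *v v - l *\<^sub>R v"
  have uV: "u \<in> V"
    using v V inv by (auto simp: u_def intro: subspace_diff subspace_scale)
  define c where "c = u \<bullet> (S *v u) - l * (u \<bullet> u)"
  have vSu: "v \<bullet> (S *v u) = u \<bullet> (S *v v)"
    by (metis inner_commute inner_matrix_vector_transpose sym)
  \<comment> \<open>This is \<open>bound\<close> at \<open>v + t *\<^sub>R u\<close>: the terms of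
    order zero cancel, and symmetry makes the first-order coefficient exactly
    \<open>2 * (u \<bullet> u)\<close>.\<close>
  have quad: "2 * t * (u \<bullet> u) + t\<^sup>2 * c \<le> 0" for t
  proof -
    have "v + t *\<^sub>R u \<in> V"
      using v V uV by (auto intro: subspace_add subspace_scale)
    from bound[OF this] have "l + 2 * t * (u \<bullet> (S *v v)) + t\<^sup>2 * (u \<bullet> (S *v u))
        \<le> l * (v \<bullet> v + 2 * t * (u \<bullet> v) + t\<^sup>2 * (u \<bullet> u))"
      by (simp add: l_def matrix_vector_mult_scaleR matrix_vector_right_distrib vSu inner_simps
          inner_commute[of v u] power2_eq_square algebra_simps)
    moreover have "v \<bullet> v = 1"
      using v by (simp add: norm_eq_1)
    moreover have "u \<bullet> (S *v v) = u \<bullet> u + l * (u \<bullet> v)"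
    proof -
      have "S *v v = u + l *\<^sub>R v"
        by (simp add: u_def)
      then show ?thesis
        by (simp add: inner_simps)
    qed
    ultimately show ?thesis
      by (simp add: c_def algebra_simps)
  qed
  have "u \<bullet> u \<le> 0"
  proof (rule ccontr)
    assume "\<not> u \<bullet> u \<le> 0"
    then have a: "u \<bullet> u > 0" by linarith
    \<comment> \<open>This \<open>t\<close> is small enough that the second-order term cannot
      outweigh the first-order one; the \<open>+ 1\<close> covers \<open>c = 0\<close>.\<close>
    define t where "t = (u \<bullet> u) / (\<bar>c\<bar> + 1)"
    have t: "t > 0" using a by (simp add: t_def)
    have "t * \<bar>c\<bar> \<le> u \<bullet> u"
      using a by (simp add: t_def field_simps)
    moreover have "t * \<bar>c\<bar> = \<bar>t * c\<bar>"
      using t by (simp add: abs_mult)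
    ultimately have "2 * (u \<bullet> u) + t * c > 0"
      using a by linarith
    then have "t * (2 * (u \<bullet> u) + t * c) > 0"
      using t by simp
    with quad[of t] show False
      by (simp add: power2_eq_square algebra_simps)
  qed
  then have "u = 0"
    by (metis inner_gt_zero_iff not_le)
  then show thesis
    using that[of v l] v by (simp add: u_def)
qed

text \<open>By symmetry the orthogonal complement of the eigenvectors found so far is invariant
  under \<open>S\<close>. While there are fewer of them than the dimension, it is nonzero and
  \<open>rayleigh_eigenvector\<close> supplies another one.\<close>

lemma orthonormal_eigenvectors:
  fixes S :: "real^'n^'n"
  assumes sym: "transpose S = S" and "k \<le> CARD('n)"
  shows "\<exists>B. finite B \<and> card B = k \<and> pairwise orthogonal B \<and>
           (\<forall>b\<in>B. norm b = 1 \<and> (\<exists>l. S *v b = l *\<^sub>R b))"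
  using \<open>k \<le> CARD('n)\<close>
proof (induction k)
  case 0
  show ?case by (rule exI[of _ "{}"]) auto
next
  case (Suc k)
  then obtain B where B: "finite B" "card B = k" "pairwise orthogonal B"
    and eig: "\<And>b. b \<in> B \<Longrightarrow> norm b = 1 \<and> (\<exists>l. S *v b = l *\<^sub>R b)"
    by auto
  have "dim B < DIM(real^'n)"
    using dim_le_card'[OF B(1)] B(2) Suc.prems by simp
  then obtain x0 where x0: "x0 \<noteq> 0" "\<And>z. z \<in> span B \<Longrightarrow> orthogonal x0 z"
    by (rule orthogonal_to_subspace_exists) blast
  let ?V = "{x. \<forall>b\<in>B. orthogonal b x}"
  have V: "subspace ?V"
    by (auto simp: subspace_def orthogonal_clauses)
  have inv: "S *v x \<in> ?V" if "x \<in> ?V" for x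
  proof clarify
    fix b assume b: "b \<in> B"
    then obtain l where "S *v b = l *\<^sub>R b" using eig by blast
    then have "b \<bullet> (S *v x) = l * (b \<bullet> x)"
      by (simp add: inner_matrix_vector_transpose sym)
    then show "orthogonal b (S *v x)"
      using that b by (simp add: orthogonal_def)
  qed
  have "x0 \<in> ?V"
    using x0(2) by (auto simp: orthogonal_commute span_base)
  then obtain v l where v: "v \<in> ?V" "norm v = 1" "S *v v = l *\<^sub>R v"
    using rayleigh_eigenvector[OF sym V inv _ x0(1)] by blast
  \<comment> \<open>A unit vector is not orthogonal to itself, so the cardinality really
    grows.\<close>
  have "v \<notin> B"
    using v by (auto simp: orthogonal_def)
  moreover have "pairwise orthogonal (insert v B)"
    using B(3) v(1) by (auto simp: pairwise_insert orthogonal_commute)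
  ultimately show ?case
    using B eig v by (intro exI[of _ "insert v B"]) auto
qed

theorem symmetric_matrix_diagonalization:
  fixes S :: "real^'n^'n"
  assumes sym: "transpose S = S"
  obtains U d where "orthogonal_matrix U" "S = transpose U ** diag_matrix d ** U"
proof -
  obtain B where B: "finite B" "card B = CARD('n)" "pairwise orthogonal B"
    and eig: "\<And>b. b \<in> B \<Longrightarrow> norm b = 1 \<and> (\<exists>l. S *v b = l *\<^sub>R b)"
    using orthonormal_eigenvectors[OF sym order_refl] by auto
  \<comment> \<open>Orthonormal eigenvectors, as many as the dimension, are indexed by
    \<open>'n\<close> so that they can serve as the rows of \<open>U\<close>; the eigenvector
    equations then read \<open>U ** S = diag_matrix d ** U\<close>.\<close>
  obtain e where e: "bij_betw e (UNIV :: 'n set) B"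
    using B by (metis finite finite_same_card_bij)
  have eB: "e i \<in> B" for i
    using e by (auto simp: bij_betw_def)
  obtain d where d: "\<And>i. S *v e i = d i *\<^sub>R e i"
    using eig[OF eB] by metis
  define U where "U = (\<chi> i. e i)"
  have row: "row i U = e i" for i
    by (simp add: U_def row_def)
  have U: "orthogonal_matrix U"
    unfolding orthogonal_matrix_orthonormal_rows row
    using eig eB B(3) bij_betw_imp_inj_on[OF e] unfolding pairwise_def by (metis inj_eq)
  have "(U ** S) *v x = (diag_matrix d ** U) *v x" for x
  proof (unfold vec_eq_iff, intro allI)
    fix i
    have "e i \<bullet> (S *v x) = d i * (e i \<bullet> x)"
      by (simp add: inner_matrix_vector_transpose sym d)
    then show "((U ** S) *v x) $ i = ((diag_matrix d ** U) *v x) $ i"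
      by (simp add: diag_matrix_mult_vector flip: matrix_vector_mul_assoc)
        (simp add: matrix_vector_mul_component U_def)
  qed
  then have "U ** S = diag_matrix d ** U"
    by (simp add: matrix_eq)
  then have "transpose U ** U ** S = transpose U ** diag_matrix d ** U"
    by (simp flip: matrix_mul_assoc)
  with U that show thesis
    by (simp add: orthogonal_matrix)
qed

text \<open>Since conjugation by a fixed orthogonal matrix respects products, square roots and
  inverses can be computed on the diagonal entries.\<close>

lemma orthogonal_conjugation_mult:
  fixes U :: "real^'n^'n"
  assumes "orthogonal_matrix U"
  shows "(transpose U ** B ** U) ** (transpose U ** C ** U) = transpose U ** (B ** C) ** U"
proof -
  have "(transpose U ** B ** U) ** (transpose U ** C ** U)
      = transpose U ** (B ** ((U ** transpose U) ** (C ** U)))"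
    by (simp only: matrix_mul_assoc)
  also have "\<dots> = transpose U ** (B ** C) ** U"
    using assms by (simp add: orthogonal_matrix_def) (simp only: matrix_mul_assoc)
  finally show ?thesis .
qed

lemma inner_orthogonal_diagonal:
  fixes U :: "real^'n^'n"
  shows "x \<bullet> ((transpose U ** diag_matrix d ** U) *v x) = (\<Sum>i\<in>UNIV. d i * ((U *v x) $ i)\<^sup>2)"
proof -
  have "x \<bullet> ((transpose U ** diag_matrix d ** U) *v x) = (U *v x) \<bullet> (diag_matrix d *v (U *v x))"
    by (metis inner_matrix_vector_transpose matrix_vector_mul_assoc transpose_transpose)
  then show ?thesis
    by (simp add: inner_vec_def diag_matrix_mult_vector power2_eq_square mult_ac)
qed

lemma sym_pd_diagonalization:
  fixes S :: "real^'n^'n"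
  assumes "sym_pd S"
  obtains U d where "orthogonal_matrix U" "S = transpose U ** diag_matrix d ** U" "\<And>i. d i > 0"
proof -
  obtain U d where U: "orthogonal_matrix U" and S: "S = transpose U ** diag_matrix d ** U"
    using symmetric_matrix_diagonalization[of S] assms by (auto simp: sym_pd_def)
  have "d i > 0" for i
  proof -
    \<comment> \<open>The eigenvector for \<open>d i\<close>: in the coordinates given by
      \<open>U\<close> it is the unit vector of index \<open>i\<close>, so the quadratic form takes
      the value \<open>d i\<close> there.\<close>
    let ?x = "transpose U *v axis i 1"
    have Ux: "U *v ?x = axis i 1"
      using U by (simp add: matrix_vector_mul_assoc orthogonal_matrix_def del: transpose_matrix_vector)
    then have "?x \<noteq> 0"
      by (metis axis_eq_0_iff matrix_vector_mult_0_right one_neq_zero)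
    then have "0 < ?x \<bullet> (S *v ?x)"
      using assms unfolding sym_pd_def by blast
    also have "\<dots> = (\<Sum>j\<in>UNIV. d j * ((axis i 1 :: real^'n) $ j)\<^sup>2)"
      unfolding S inner_orthogonal_diagonal Ux ..
    also have "\<dots> = d i"
      by (simp add: axis_def if_distrib[of "\<lambda>x. x\<^sup>2"] if_distrib[of "(*) c" for c] cong: if_cong)
    finally show ?thesis .
  qed
  with U S that show thesis by blast
qed

section \<open>Square roots, inverses and closure properties of positive definite matrices\<close>

text \<open>The choice in \<open>matrix_sqrt\<close> has its defining property once a witness
  exists; taking square roots of the eigenvalues provides one.\<close>

lemma matrix_sqrt_works:
  assumes "sym_pd S"
  shows "sym_psd (matrix_sqrt S) \<and> matrix_sqrt S ** matrix_sqrt S = S"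
proof -
  obtain U d where U: "orthogonal_matrix U" and S: "S = transpose U ** diag_matrix d ** U"
    and d: "\<And>i. d i > 0"
    using sym_pd_diagonalization[OF assms] by blast
  let ?B = "transpose U ** diag_matrix (\<lambda>i. sqrt (d i)) ** U"
  have "?B ** ?B = S"
    using d by (simp add: orthogonal_conjugation_mult[OF U] diag_matrix_mult S less_imp_le
        flip: real_sqrt_mult)
  moreover have "sym_psd ?B"
    using d by (auto simp: sym_psd_def inner_orthogonal_diagonal matrix_transpose_mul matrix_mul_assoc
        less_imp_le intro!: sum_nonneg mult_nonneg_nonneg)
  ultimately show ?thesis
    unfolding matrix_sqrt_def by (intro someI_ex[where P="\<lambda>B. sym_psd B \<and> B ** B = S"]) blast
qed

text \<open>For square matrices a one-sided inverse is two-sided, and two-sided inverses are unique,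
  so the matrix chosen by \<open>matrix_inv\<close> must be \<open>C\<close>.\<close>

lemma matrix_inv_eqI:
  fixes B C :: "real^'n^'n"
  assumes "B ** C = mat 1"
  shows "matrix_inv B = C"
proof -
  have CB: "C ** B = mat 1"
    using assms by (simp add: matrix_left_right_inverse)
  have "B ** matrix_inv B = mat 1 \<and> matrix_inv B ** B = mat 1"
    unfolding matrix_inv_def by (rule someI[of _ C]) (use assms CB in blast)
  then show ?thesis
    by (metis CB matrix_mul_assoc matrix_mul_lid matrix_mul_rid)
qed

lemma sym_pd_inverse:
  fixes S :: "real^'n^'n"
  assumes "sym_pd S"
  shows "S ** matrix_inv S = mat 1" "matrix_inv S ** S = mat 1"
proof -
  have "x = 0" if "S *v x = 0" for x
    using assms that by (force simp: sym_pd_def)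
  then obtain B where "B ** S = mat 1"
    by (metis matrix_left_invertible_ker)
  then have "S ** B = mat 1"
    by (simp add: matrix_left_right_inverse)
  then show "S ** matrix_inv S = mat 1"
    using matrix_inv_eqI by metis
  then show "matrix_inv S ** S = mat 1"
    by (simp add: matrix_left_right_inverse)
qed

lemma sym_pd_matrix_inv:
  fixes S :: "real^'n^'n"
  assumes "sym_pd S"
  shows "sym_pd (matrix_inv S)"
proof -
  note I = sym_pd_inverse[OF assms]
  have S: "transpose S = S"
    using assms by (simp add: sym_pd_def)
  have "S ** transpose (matrix_inv S) = mat 1"
    by (metis I(2) S matrix_transpose_mul transpose_mat)
  then have "transpose (matrix_inv S) = matrix_inv S"
    using matrix_inv_eqI by metis
  moreover have "0 < v \<bullet> (matrix_inv S *v v)" if "v \<noteq> 0" for v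
  proof -
    \<comment> \<open>With \<open>v = S *v ?u\<close>, the form of the inverse at \<open>v\<close>
      equals the form of \<open>S\<close> at \<open>?u\<close>.\<close>
    let ?u = "matrix_inv S *v v"
    have v: "v = S *v ?u"
      by (simp add: matrix_vector_mul_assoc I)
    then have "?u \<noteq> 0"
      using that by (metis matrix_vector_mult_0_right)
    then have "0 < ?u \<bullet> (S *v ?u)"
      using assms unfolding sym_pd_def by blast
    then show ?thesis
      using v by (simp add: inner_commute)
  qed
  ultimately show ?thesis
    by (simp add: sym_pd_def)
qed

text \<open>The congruence is only positive semidefinite for a general rectangular \<open>A\<close>;
  the summand \<open>Q\<close> makes the sum definite. This covers forecast and innovation
  covariances and, applied to inverses with \<open>transpose A\<close>, posterior
  precisions.\<close>

lemma sym_pd_congruence_add: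
  fixes P :: "real^'n^'n" and A :: "real^'n^'m"
  assumes "sym_pd P" "sym_pd Q"
  shows "sym_pd (A ** P ** transpose A + Q)"
proof -
  have "0 \<le> v \<bullet> ((A ** P ** transpose A) *v v)" for v
  proof -
    have "v \<bullet> ((A ** P ** transpose A) *v v) = (transpose A *v v) \<bullet> (P *v (transpose A *v v))"
      by (metis inner_matrix_vector_transpose matrix_vector_mul_assoc)
    also have "\<dots> \<ge> 0"
      using assms(1) by (cases "transpose A *v v = 0") (auto simp: sym_pd_def intro: less_imp_le)
    finally show ?thesis .
  qed
  moreover have "transpose (A ** P ** transpose A) = A ** P ** transpose A"
    using assms(1) by (simp add: matrix_transpose_mul matrix_mul_assoc sym_pd_def)
  moreover have "transpose (B + C) = transpose B + transpose C" for B C :: "real^'m^'m"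
    by (simp add: transpose_def vec_eq_iff)
  ultimately show ?thesis
    using assms(2) unfolding sym_pd_def
    by (auto simp: matrix_vector_mult_add_rdistrib inner_add_right add_nonneg_pos)
qed

lemma sym_pd_scaleR: "sym_pd S \<Longrightarrow> c > 0 \<Longrightarrow> sym_pd (c *\<^sub>R S)"
  by (auto simp: sym_pd_def transpose_scalar scaleR_matrix_vector_assoc[symmetric])

lemma matrix_inv_orthogonal_diagonal:
  fixes U :: "real^'n^'n"
  assumes "orthogonal_matrix U" "\<And>i. d i \<noteq> 0"
  shows "matrix_inv (transpose U ** diag_matrix d ** U) = transpose U ** diag_matrix (\<lambda>i. 1 / d i) ** U"
  using assms(1) by (intro matrix_inv_eqI)
    (simp add: orthogonal_conjugation_mult diag_matrix_mult assms diag_matrix_one orthogonal_matrix)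

lemma det_orthogonal_diagonal:
  fixes U :: "real^'n^'n"
  assumes "orthogonal_matrix U"
  shows "det (transpose U ** diag_matrix d ** U) = (\<Prod>i\<in>UNIV. d i)"
  using det_orthogonal_matrix[OF assms] by (auto simp: det_mul det_diag_matrix det_transpose)

lemma weighted_norm_sq_nonneg: "sym_pd S \<Longrightarrow> 0 \<le> weighted_norm_sq S v"
  by (cases "v = 0") (auto simp: weighted_norm_sq_def sym_pd_def intro: less_imp_le)

section \<open>Invariance of Lebesgue measure\<close>

lemma nn_integral_lborel_translation:
  fixes g :: "'a::euclidean_space \<Rightarrow> ennreal"
  assumes [measurable]: "g \<in> borel_measurable borel"
  shows "(\<integral>\<^sup>+x. g (x - a) \<partial>lborel) = (\<integral>\<^sup>+x. g x \<partial>lborel)"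
  by (subst (2) lborel_distr_plus[of "- a", symmetric]) (simp add: nn_integral_distr)

lemma nn_integral_lborel_reflection:
  fixes g :: "'a::euclidean_space \<Rightarrow> ennreal"
  assumes [measurable]: "g \<in> borel_measurable borel"
  shows "(\<integral>\<^sup>+x. g (a - x) \<partial>lborel) = (\<integral>\<^sup>+x. g x \<partial>lborel)"
  by (subst (2) lborel_affine[of "-1" a]) (simp_all add: nn_integral_distr nn_integral_density)

text \<open>Evaluating \<open>\<integral>\<integral> g (f x) h (y - f x)\<close> in both orders shows that pulling back along a linear
  bijection multiplies all integrals by the same factor.\<close>

lemma nn_integral_lborel_linear_exchange:
  fixes f :: "'a::euclidean_space \<Rightarrow> 'a" and g h :: "'a \<Rightarrow> ennreal"
  assumes f: "linear f" "bij f"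
    and [measurable]: "g \<in> borel_measurable borel" "h \<in> borel_measurable borel"
  shows "(\<integral>\<^sup>+x. g (f x) \<partial>lborel) * (\<integral>\<^sup>+y. h y \<partial>lborel)
       = (\<integral>\<^sup>+x. h (f x) \<partial>lborel) * (\<integral>\<^sup>+y. g y \<partial>lborel)"
proof -
  have [measurable]: "f \<in> borel_measurable borel"
    using f by (intro borel_measurable_continuous_onI linear_continuous_on)
      (simp add: linear_conv_bounded_linear)
  obtain f' where f': "\<And>y. f (f' y) = y"
    using f(2) by (metis bij_inv_eq_iff)
  have "(\<integral>\<^sup>+x. g (f x) \<partial>lborel) * (\<integral>\<^sup>+y. h y \<partial>lborel)
      = (\<integral>\<^sup>+x. g (f x) * (\<integral>\<^sup>+y. h (y - f x) \<partial>lborel) \<partial>lborel)"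
    by (simp add: nn_integral_multc nn_integral_lborel_translation)
  also have "\<dots> = (\<integral>\<^sup>+x. \<integral>\<^sup>+y. g (f x) * h (y - f x) \<partial>lborel \<partial>lborel)"
    by (simp add: nn_integral_cmult)
  also have "\<dots> = (\<integral>\<^sup>+y. \<integral>\<^sup>+x. g (f x) * h (y - f x) \<partial>lborel \<partial>lborel)"
    by (rule lborel_pair.Fubini') measurable
  \<comment> \<open>Reflecting the inner variable about \<open>f' y\<close>, the preimage of
    \<open>y\<close>, turns \<open>f x\<close> into \<open>y - f x\<close> by linearity and so swaps
    the roles of \<open>g\<close> and \<open>h\<close>.\<close>
  also have "\<dots> = (\<integral>\<^sup>+y. \<integral>\<^sup>+x. g (f (f' y - x)) * h (y - f (f' y - x)) \<partial>lborel \<partial>lborel)"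
    by (intro nn_integral_cong nn_integral_lborel_reflection[symmetric]) measurable
  also have "\<dots> = (\<integral>\<^sup>+y. \<integral>\<^sup>+x. h (f x) * g (y - f x) \<partial>lborel \<partial>lborel)"
    by (simp add: linear_diff[OF f(1)] f' mult.commute)
  also have "\<dots> = (\<integral>\<^sup>+x. \<integral>\<^sup>+y. h (f x) * g (y - f x) \<partial>lborel \<partial>lborel)"
    by (rule lborel_pair.Fubini') measurable
  also have "\<dots> = (\<integral>\<^sup>+x. h (f x) * (\<integral>\<^sup>+y. g (y - f x) \<partial>lborel) \<partial>lborel)"
    by (simp add: nn_integral_cmult)
  also have "\<dots> = (\<integral>\<^sup>+x. h (f x) \<partial>lborel) * (\<integral>\<^sup>+y. g y \<partial>lborel)"
    by (simp add: nn_integral_multc nn_integral_lborel_translation)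
  finally show ?thesis .
qed

text \<open>The common factor from \<open>nn_integral_lborel_linear_exchange\<close> is found by
  testing on the unit ball, which \<open>f\<close> preserves. Its volume is positive and finite,
  hence can be cancelled.\<close>

lemma nn_integral_lborel_orthogonal:
  fixes f :: "'a::euclidean_space \<Rightarrow> 'a" and g :: "'a \<Rightarrow> ennreal"
  assumes f: "orthogonal_transformation f" and [measurable]: "g \<in> borel_measurable borel"
  shows "(\<integral>\<^sup>+x. g (f x) \<partial>lborel) = (\<integral>\<^sup>+x. g x \<partial>lborel)"
proof -
  let ?b = "emeasure lborel (cball (0::'a) 1)"
  let ?h = "indicator (cball (0::'a) 1) :: 'a \<Rightarrow> ennreal"
  have "?h (f x) = ?h x" for x
    using f by (auto simp: orthogonal_transformation_norm indicator_def)
  then have "(\<integral>\<^sup>+x. g (f x) \<partial>lborel) * ?b = ?b * (\<integral>\<^sup>+x. g x \<partial>lborel)"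
    using nn_integral_lborel_linear_exchange[of f g ?h] f borel_measurable_indicator[of "cball (0::'a) 1" borel]
    by (simp add: orthogonal_transformation_linear orthogonal_transformation_bij)
  moreover have "unit_ball_vol (real DIM('a)) > 0"
    by simp
  then have "?b \<noteq> 0" "?b \<noteq> \<top>"
    by (simp_all add: emeasure_cball less_le)
  ultimately show ?thesis
    by (simp add: mult.commute[of _ ?b] ennreal_mult_cancel_left)
qed

lemma nn_integral_lborel_cart_prod:
  fixes F :: "'n::finite \<Rightarrow> real \<Rightarrow> ennreal"
  assumes "\<And>i. F i \<in> borel_measurable borel"
  shows "(\<integral>\<^sup>+x. (\<Prod>i\<in>UNIV. F i (x $ i)) \<partial>lborel) = (\<Prod>i\<in>UNIV. \<integral>\<^sup>+t. F i t \<partial>lborel)"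
proof -
  have B: "(Basis :: (real^'n) set) = (\<lambda>i. axis i 1) ` UNIV"
    by (auto simp: Basis_vec_def)
  have inj: "inj (\<lambda>i. axis i (1::real) :: real^'n)"
    by (simp add: inj_def axis_eq_axis)
  have "(\<integral>\<^sup>+x. (\<Prod>b\<in>(Basis :: (real^'n) set). F (axis_index b) (x \<bullet> b)) \<partial>lborel)
      = (\<Prod>b\<in>(Basis :: (real^'n) set). \<integral>\<^sup>+t. F (axis_index b) t \<partial>lborel)"
    by (rule nn_integral_lborel_prod) (use assms in auto)
  then show ?thesis
    by (simp add: B prod.reindex[OF inj] inner_axis)
qed

section \<open>Gaussian densities\<close>

lemma sym_pd_det_pos:
  assumes "sym_pd P"
  shows "det P > 0"
proof -
  obtain U d where "orthogonal_matrix U" "P = transpose U ** diag_matrix d ** U" "\<And>i. d i > 0"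
    using sym_pd_diagonalization[OF assms] by blast
  then show ?thesis
    by (simp add: det_orthogonal_diagonal prod_pos)
qed

lemma gauss_density_pos: "sym_pd P \<Longrightarrow> 0 < gauss_density m P x"
  by (simp add: gauss_density_def sym_pd_det_pos)

lemma prod_sqrt: "(\<Prod>i\<in>I. sqrt (f i)) = sqrt (\<Prod>i\<in>I. f i)"
  by (induction I rule: infinite_finite_induct) (auto simp: real_sqrt_mult)

text \<open>In the eigenbasis of the covariance the coordinates are independent with variances
  \<open>d i\<close>, which reduces the normalization to dimension one.\<close>

lemma gauss_density_diagonal:
  fixes U :: "real^'n^'n"
  assumes U: "orthogonal_matrix U" and d: "\<And>i. d i > 0"
  shows "gauss_density m (transpose U ** diag_matrix d ** U) x
       = (\<Prod>i\<in>UNIV. normal_density 0 (sqrt (d i)) ((U *v (x - m)) $ i))"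
proof -
  have [simp]: "d i \<noteq> 0" "d i \<ge> 0" for i
    using d[of i] by auto
  have "(\<Prod>i\<in>UNIV. normal_density 0 (sqrt (d i)) ((U *v (x - m)) $ i))
      = exp (- (\<Sum>i\<in>UNIV. ((U *v (x - m)) $ i)\<^sup>2 / (2 * d i))) / sqrt (\<Prod>i\<in>UNIV. 2 * pi * d i)"
    by (simp add: normal_density_def prod_dividef prod.distrib exp_sum real_sqrt_mult
        sum_negf[symmetric] prod_sqrt real_sqrt_power power_mult_distrib)
  also have "\<dots> = gauss_density m (transpose U ** diag_matrix d ** U) x"
    using U by (simp add: gauss_density_def weighted_norm_sq_def matrix_inv_orthogonal_diagonal
        det_orthogonal_diagonal inner_orthogonal_diagonal prod.distrib sum_divide_distrib mult_ac)
  finally show ?thesis ..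
qed

lemma continuous_weighted_norm_sq [continuous_intros]:
  fixes f :: "'a::topological_space \<Rightarrow> real^'n"
  shows "continuous_on S f \<Longrightarrow> continuous_on S (\<lambda>x. weighted_norm_sq B (f x))"
  unfolding weighted_norm_sq_def
  by (intro continuous_intros continuous_on_compose2[OF matrix_vector_mult_linear_continuous_on[of UNIV B]]) auto

lemma continuous_gauss_density [continuous_intros]:
  fixes f g :: "'a::topological_space \<Rightarrow> real^'n"
  assumes "sym_pd P" "continuous_on S f" "continuous_on S g"
  shows "continuous_on S (\<lambda>x. gauss_density (f x) P (g x))"
  unfolding gauss_density_def
  by (intro continuous_intros assms) (use sym_pd_det_pos[OF assms(1)] in auto)

text \<open>Translation and rotation into the eigenbasis preserve Lebesgue measure, and there the
  integral is a product of one-dimensional normal integrals.\<close>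

lemma nn_integral_gauss_density:
  fixes P :: "real^'n^'n"
  assumes "sym_pd P"
  shows "(\<integral>\<^sup>+x. ennreal (gauss_density m P x) \<partial>lborel) = 1"
proof -
  obtain U d where U: "orthogonal_matrix U" and P: "P = transpose U ** diag_matrix d ** U"
    and d: "\<And>i. d i > 0"
    using sym_pd_diagonalization[OF assms] by blast
  define G where "G u = (\<Prod>i\<in>UNIV. ennreal (normal_density 0 (sqrt (d i)) (u $ i)))" for u :: "real^'n"
  have [measurable]: "G \<in> borel_measurable borel"
    unfolding G_def by measurable
  have "orthogonal_transformation ((*v) U)"
    using U by (simp add: orthogonal_transformation_matrix)
  then have "(\<integral>\<^sup>+x. G (U *v x) \<partial>lborel) = (\<integral>\<^sup>+x. G x \<partial>lborel)"
    by (rule nn_integral_lborel_orthogonal) simp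
  also have "\<dots> = 1"
    unfolding G_def using d
    by (subst nn_integral_lborel_cart_prod)
      (simp_all add: nn_integral_eq_integral integrable_normal_density integral_normal_density)
  finally have "(\<integral>\<^sup>+x. G (U *v x) \<partial>lborel) = 1" .
  moreover have [measurable]: "(*v) U \<in> borel_measurable borel"
    by (intro borel_measurable_continuous_onI matrix_vector_mult_linear_continuous_on)
  have "(\<lambda>x. G (U *v x)) \<in> borel_measurable borel"
    by measurable
  ultimately have "(\<integral>\<^sup>+x. G (U *v (x - m)) \<partial>lborel) = 1"
    using nn_integral_lborel_translation[of "\<lambda>x. G (U *v x)" m] by simp
  then show ?thesis
    by (simp add: P gauss_density_diagonal[OF U d] G_def prod_ennreal)
qed

lemma borel_measurable_gauss_density:
  "sym_pd P \<Longrightarrow> gauss_density m P \<in> borel_measurable borel"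
  by (intro borel_measurable_continuous_onI continuous_intros)

lemma integral_gauss_density:
  assumes "sym_pd P"
  shows "(\<integral>x. gauss_density m P x \<partial>lborel) = 1"
  using nn_integral_gauss_density[OF assms, of m] borel_measurable_gauss_density[OF assms, of m]
  by (subst integral_eq_nn_integral) (auto simp: gauss_density_pos[OF assms] less_imp_le)

section \<open>Gaussian conditioning and the Kalman update\<close>

lemma matrix_mult_add_right_distrib:
  fixes B C :: "real^'n^'m"
  shows "(B + C) ** D = B ** D + C ** D"
  by (simp add: matrix_matrix_mult_def vec_eq_iff sum.distrib algebra_simps)

lemma matrix_mult_diff_left_distrib:
  fixes B :: "real^'n^'m"
  shows "B ** (C - D) = B ** C - B ** D"
  by (simp add: matrix_matrix_mult_def vec_eq_iff sum_subtractf algebra_simps)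

text \<open>Woodbury-type identities relating the innovation covariance \<open>S\<close>, the gain
  \<open>K\<close> and the posterior precision \<open>L\<close>. They identify \<open>K\<close> and
  the posterior covariance through \<open>L\<close>, the form in which completing the square
  produces them.\<close>

lemma kalman_precision:
  fixes A :: "real^'n^'m"
  assumes P: "sym_pd P" and Q: "sym_pd Q"
  defines "S \<equiv> A ** P ** transpose A + Q"
  defines "K \<equiv> P ** transpose A ** matrix_inv S"
  defines "L \<equiv> transpose A ** matrix_inv Q ** A + matrix_inv P"
  shows "L ** K = transpose A ** matrix_inv Q" "L ** (P - K ** A ** P) = mat 1"
    and "matrix_inv S + matrix_inv S ** A ** P ** transpose A ** matrix_inv Q = matrix_inv Q"
proof -
  have S: "sym_pd S"
    unfolding S_def by (rule sym_pd_congruence_add[OF P Q])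
  note I = sym_pd_inverse[OF P] sym_pd_inverse[OF Q] sym_pd_inverse[OF S]
  let ?T = "A ** P ** transpose A"
  \<comment> \<open>\<open>S\<close> is cancelled against its inverse and also expanded into its two
    summands; comparing the results, with \<open>matrix_inv Q\<close> on the left here and on the
    right below, yields two identities.\<close>
  have "matrix_inv Q ** S ** matrix_inv S = matrix_inv Q"
    by (simp add: I flip: matrix_mul_assoc)
  then have 1: "matrix_inv Q ** ?T ** matrix_inv S + matrix_inv S = matrix_inv Q"
    unfolding S_def by (simp add: matrix_add_ldistrib matrix_mult_add_right_distrib I)
  have "matrix_inv S ** S ** matrix_inv Q = matrix_inv Q"
    by (simp add: I)
  then have "matrix_inv S ** ?T ** matrix_inv Q + matrix_inv S ** Q ** matrix_inv Q = matrix_inv Q"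
    by (subst (asm) (2) S_def) (simp add: matrix_add_ldistrib matrix_mult_add_right_distrib)
  then show "matrix_inv S + matrix_inv S ** A ** P ** transpose A ** matrix_inv Q = matrix_inv Q"
    by (simp add: I matrix_mul_assoc add.commute flip: matrix_mul_assoc[of _ Q])
  have "L ** K = transpose A ** (matrix_inv Q ** ?T ** matrix_inv S + matrix_inv S)"
    by (simp add: L_def K_def matrix_add_ldistrib matrix_mult_add_right_distrib matrix_mul_assoc I)
  then show LK: "L ** K = transpose A ** matrix_inv Q"
    by (simp add: 1)
  have "L ** (P - K ** A ** P) = L ** P - L ** K ** A ** P"
    by (simp add: matrix_mult_diff_left_distrib matrix_mul_assoc)
  also have "\<dots> = L ** P - transpose A ** matrix_inv Q ** A ** P"
    by (simp only: LK)
  also have "\<dots> = mat 1"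
    by (simp add: L_def matrix_mult_add_right_distrib I)
  finally show "L ** (P - K ** A ** P) = mat 1" .
qed

lemma weighted_norm_sq_diff:
  fixes B :: "real^'n^'n"
  assumes "transpose B = B"
  shows "weighted_norm_sq B (a - b) = weighted_norm_sq B a - 2 * (a \<bullet> (B *v b)) + weighted_norm_sq B b"
proof -
  have "b \<bullet> (B *v a) = a \<bullet> (B *v b)"
    by (metis assms inner_commute inner_matrix_vector_transpose)
  then show ?thesis
    by (simp add: weighted_norm_sq_def matrix_vector_mult_diff_distrib inner_simps)
qed

text \<open>Completing the square in \<open>x\<close>. In terms of the innovation \<open>e\<close>
  and the deviation \<open>u\<close>, the mixed terms agree because
  \<open>L ** K = transpose A ** matrix_inv Q\<close>, and the terms in \<open>e\<close> alone agree
  by the third identity of \<open>kalman_precision\<close>.\<close>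

lemma kalman_quadratic_form:
  fixes A :: "real^'n^'m"
  assumes P: "sym_pd P" and Q: "sym_pd Q"
  defines "S \<equiv> A ** P ** transpose A + Q"
  defines "K \<equiv> P ** transpose A ** matrix_inv S"
  defines "L \<equiv> transpose A ** matrix_inv Q ** A + matrix_inv P"
  shows "weighted_norm_sq (matrix_inv Q) (z - A *v x) + weighted_norm_sq (matrix_inv P) (x - m)
       = weighted_norm_sq (matrix_inv S) (z - A *v m)
         + weighted_norm_sq L (x - (m + K *v (z - A *v m)))"
proof -
  define e u where "e = z - A *v m" and "u = x - m"
  have S: "sym_pd S"
    unfolding S_def by (rule sym_pd_congruence_add[OF P Q])
  have L: "sym_pd L"
    using sym_pd_congruence_add[OF sym_pd_matrix_inv[OF Q] sym_pd_matrix_inv[OF P], of "transpose A"]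
    by (simp add: L_def)
  have sym: "transpose (matrix_inv Q) = matrix_inv Q" "transpose L = L" "transpose P = P"
    "transpose (matrix_inv S) = matrix_inv S"
    using L P sym_pd_matrix_inv[OF S] sym_pd_matrix_inv[OF Q] by (auto simp: sym_pd_def)
  note kp = kalman_precision[OF P Q, of A, folded S_def, folded K_def L_def]
  have "weighted_norm_sq (matrix_inv Q) (e - A *v u)
      = weighted_norm_sq (matrix_inv Q) e - 2 * (e \<bullet> ((matrix_inv Q ** A) *v u))
        + weighted_norm_sq (matrix_inv Q) (A *v u)"
    by (simp add: weighted_norm_sq_diff[OF sym(1)] matrix_vector_mul_assoc)
  moreover have "e \<bullet> ((matrix_inv Q ** A) *v u) = u \<bullet> ((transpose A ** matrix_inv Q) *v e)"
    by (metis inner_commute inner_matrix_vector_transpose matrix_transpose_mul sym(1))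
  moreover have "weighted_norm_sq L (u - K *v e)
      = weighted_norm_sq L u - 2 * (u \<bullet> ((transpose A ** matrix_inv Q) *v e)) + weighted_norm_sq L (K *v e)"
    by (simp add: weighted_norm_sq_diff[OF sym(2)] matrix_vector_mul_assoc kp)
  moreover have "weighted_norm_sq L u = weighted_norm_sq (matrix_inv Q) (A *v u) + weighted_norm_sq (matrix_inv P) u"
  proof -
    have "u \<bullet> ((transpose A ** matrix_inv Q ** A) *v u) = (A *v u) \<bullet> (matrix_inv Q *v (A *v u))"
      by (metis inner_matrix_vector_transpose matrix_vector_mul_assoc transpose_transpose)
    then show ?thesis
      by (simp add: L_def weighted_norm_sq_def matrix_vector_mult_add_rdistrib inner_add_right)
  qed
  moreover have "weighted_norm_sq (matrix_inv S) e + weighted_norm_sq L (K *v e) = weighted_norm_sq (matrix_inv Q) e"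
  proof -
    have "weighted_norm_sq L (K *v e) = (K *v e) \<bullet> ((transpose A ** matrix_inv Q) *v e)"
      by (simp add: weighted_norm_sq_def matrix_vector_mul_assoc kp)
    also have "\<dots> = e \<bullet> ((transpose K ** (transpose A ** matrix_inv Q)) *v e)"
      by (metis inner_matrix_vector_transpose matrix_vector_mul_assoc transpose_transpose)
    also have "transpose K ** (transpose A ** matrix_inv Q)
        = matrix_inv S ** A ** P ** transpose A ** matrix_inv Q"
      by (simp add: K_def matrix_transpose_mul sym matrix_mul_assoc)
    finally show ?thesis
      unfolding weighted_norm_sq_def
      by (simp add: kp(3) flip: inner_add_right matrix_vector_mult_add_rdistrib)
  qed
  moreover have "z - A *v x = e - A *v u" "x - (m + K *v e) = u - K *v e"
    by (simp_all add: e_def u_def matrix_vector_mult_diff_distrib)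
  ultimately have "weighted_norm_sq (matrix_inv Q) (z - A *v x) + weighted_norm_sq (matrix_inv P) u
      = weighted_norm_sq (matrix_inv S) e + weighted_norm_sq L (x - (m + K *v e))"
    by (simp only:)
  then show ?thesis
    by (simp only: e_def u_def)
qed

text \<open>Bayes' rule for a linear Gaussian observation: likelihood times prior equals evidence
  times posterior. Definiteness of the difference \<open>P'\<close> follows from its being the
  inverse of the positive definite precision \<open>L\<close>.\<close>

theorem gauss_density_bayes:
  fixes A :: "real^'n^'m"
  assumes P: "sym_pd P" and Q: "sym_pd Q"
  defines "S \<equiv> A ** P ** transpose A + Q"
  defines "K \<equiv> P ** transpose A ** matrix_inv S"
  defines "P' \<equiv> P - K ** A ** P"
  shows sym_pd_posterior_covariance: "sym_pd P'"
    and gauss_density_mult: "gauss_density (A *v x) Q z * gauss_density m P x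
       = gauss_density (A *v m) S z * gauss_density (m + K *v (z - A *v m)) P' x"
proof -
  have S: "sym_pd S"
    unfolding S_def by (rule sym_pd_congruence_add[OF P Q])
  define L where "L = transpose A ** matrix_inv Q ** A + matrix_inv P"
  have L: "sym_pd L"
    using sym_pd_congruence_add[OF sym_pd_matrix_inv[OF Q] sym_pd_matrix_inv[OF P], of "transpose A"]
    by (simp add: L_def)
  have LP: "L ** P' = mat 1"
    using kalman_precision(2)[OF P Q, of A] by (simp add: L_def P'_def K_def S_def)
  then have "matrix_inv L = P'"
    by (rule matrix_inv_eqI)
  with sym_pd_matrix_inv[OF L] show P': "sym_pd P'"
    by simp
  have inv: "matrix_inv P' = L"
    using LP by (intro matrix_inv_eqI) (simp add: matrix_left_right_inverse)
  define G where "G z x = gauss_density (A *v m) S z * gauss_density (m + K *v (z - A *v m)) P' x" for z x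
  \<comment> \<open>The normalizing constants of the right-hand side over those of the left-hand
    side; since the exponents agree, nothing else can separate the two sides.\<close>
  define c where "c = sqrt ((2 * pi) ^ CARD('m) * det S) * sqrt ((2 * pi) ^ CARD('n) * det P')
      / (sqrt ((2 * pi) ^ CARD('m) * det Q) * sqrt ((2 * pi) ^ CARD('n) * det P))"
  have c: "c > 0"
    using sym_pd_det_pos[OF S] sym_pd_det_pos[OF P] sym_pd_det_pos[OF P'] sym_pd_det_pos[OF Q]
    by (simp add: c_def)
  have eq: "gauss_density (A *v x) Q z * gauss_density m P x = c * G z x" for x z
  proof -
    have "exp (- weighted_norm_sq (matrix_inv Q) (z - A *v x) / 2)
          * exp (- weighted_norm_sq (matrix_inv P) (x - m) / 2)
        = exp (- weighted_norm_sq (matrix_inv S) (z - A *v m) / 2)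
          * exp (- weighted_norm_sq (matrix_inv P') (x - (m + K *v (z - A *v m))) / 2)"
      using kalman_quadratic_form[OF P Q, of z A x m]
      by (simp add: inv L_def K_def S_def flip: exp_add)
    then show ?thesis
      using sym_pd_det_pos[OF S] sym_pd_det_pos[OF P']
      by (simp add: gauss_density_def G_def c_def)
  qed
  have G0: "G z x \<ge> 0" for z x
    unfolding G_def by (intro mult_nonneg_nonneg less_imp_le gauss_density_pos S P')
  note [continuous_intros] = continuous_on_compose2[OF matrix_vector_mult_linear_continuous_on[of UNIV A]]
  have meas: "(\<lambda>(z, x). ennreal (gauss_density (A *v x) Q z * gauss_density m P x))
      \<in> borel_measurable (lborel \<Otimes>\<^sub>M lborel)"
  proof -
    have "(\<lambda>p. gauss_density (A *v snd p) Q (fst p) * gauss_density m P (snd p)) \<in> borel_measurable borel"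
      by (intro borel_measurable_continuous_onI continuous_intros P Q) auto
    then show ?thesis
      by (simp add: lborel_prod split_beta)
  qed
  note nn = nn_integral_gauss_density
  note [measurable] = borel_measurable_gauss_density[OF S] borel_measurable_gauss_density[OF P']
    borel_measurable_gauss_density[OF Q]
  \<comment> \<open>The joint mass is computed twice: integrating the posterior and then the
    evidence gives \<open>c\<close>, integrating the likelihood and then the prior gives 1.\<close>
  have "ennreal c = (\<integral>\<^sup>+z. ennreal (c * gauss_density (A *v m) S z) \<partial>lborel)"
    using c by (simp add: ennreal_mult' nn_integral_cmult nn[OF S])
  also have "\<dots> = (\<integral>\<^sup>+z. \<integral>\<^sup>+x. ennreal (c * G z x) \<partial>lborel \<partial>lborel)"
    using c gauss_density_pos[OF S, THEN less_imp_le] unfolding G_def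
    by (simp add: mult.assoc[symmetric] ennreal_mult' nn_integral_cmult nn[OF P'])
  also have "\<dots> = (\<integral>\<^sup>+z. \<integral>\<^sup>+x. ennreal (gauss_density (A *v x) Q z * gauss_density m P x) \<partial>lborel \<partial>lborel)"
    by (simp add: eq)
  also have "\<dots> = (\<integral>\<^sup>+x. \<integral>\<^sup>+z. ennreal (gauss_density (A *v x) Q z * gauss_density m P x) \<partial>lborel \<partial>lborel)"
    by (rule lborel_pair.Fubini'[symmetric]) (rule meas)
  also have "\<dots> = (\<integral>\<^sup>+x. ennreal (gauss_density m P x) \<partial>lborel)"
    using gauss_density_pos[OF P, THEN less_imp_le]
    by (simp add: ennreal_mult'' nn_integral_multc nn[OF Q])
  also have "\<dots> = 1"
    by (rule nn[OF P])
  finally have "c = 1"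
    by simp
  then show "gauss_density (A *v x) Q z * gauss_density m P x
       = gauss_density (A *v m) S z * gauss_density (m + K *v (z - A *v m)) P' x"
    using eq by (simp add: G_def)
qed

text \<open>The posterior factor has mass 1, so only the evidence remains. This gives both the
  forecast density and the predictive density of the observation.\<close>

corollary integral_gauss_density_mult:
  fixes A :: "real^'n^'m"
  assumes P: "sym_pd P" and Q: "sym_pd Q"
  shows "(\<integral>x. gauss_density (A *v x) Q z * gauss_density m P x \<partial>lborel)
       = gauss_density (A *v m) (A ** P ** transpose A + Q) z"
  by (simp add: gauss_density_mult[OF P Q] integral_gauss_density[OF sym_pd_posterior_covariance[OF P Q]])

section \<open>Score matching\<close>

text \<open>The definite description in \<open>grad\<close> is resolved by uniqueness of the
  derivative, whose inner products determine the gradient vector.\<close>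

lemma grad_eqI:
  assumes "GDERIV f y :> D"
  shows "grad f y = D"
  unfolding grad_def
proof (rule the_equality[where P="\<lambda>D. GDERIV f y :> D", OF assms])
  fix D' assume "GDERIV f y :> D'"
  then have "(\<lambda>h. h \<bullet> D') = (\<lambda>h. h \<bullet> D)"
    using assms unfolding gderiv_def by (rule has_derivative_unique)
  then show "D' = D"
    by (metis vector_eq_ldot)
qed

lemma GDERIV_weighted_norm_sq:
  fixes B :: "real^'n^'n"
  assumes "transpose B = B"
  shows "GDERIV (\<lambda>z. weighted_norm_sq B (z - a)) y :> 2 *\<^sub>R (B *v (y - a))"
proof -
  have "h \<bullet> (B *v y) = y \<bullet> (B *v h)" for h y
    by (metis assms inner_commute inner_matrix_vector_transpose)
  then show ?thesis
    unfolding gderiv_def weighted_norm_sq_def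
    by (auto intro!: derivative_eq_intros bounded_linear.has_derivative[OF matrix_vector_mul_bounded_linear])
qed

text \<open>The logarithm leaves a quadratic form and a constant, so the normalizer disappears under
  the gradient.\<close>

lemma lik_score_eq:
  fixes R :: "real^'y^'y" and H :: "real^'x^'y"
  assumes R: "sym_pd R"
  shows "lik_score H R x y = - (matrix_inv R *v (y - H *v x))"
proof -
  have pos: "0 < (2 * pi) ^ CARD('y) * det R"
    using sym_pd_det_pos[OF R] by simp
  have "ln (gauss_density (H *v x) R z)
      = (- 1 / 2) * weighted_norm_sq (matrix_inv R) (z - H *v x) - ln (sqrt ((2 * pi) ^ CARD('y) * det R))" for z
    using pos sym_pd_det_pos[OF R] by (simp add: gauss_density_def ln_div)
  moreover have sym: "transpose (matrix_inv R) = matrix_inv R"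
    using sym_pd_matrix_inv[OF R] by (simp add: sym_pd_def)
  have "GDERIV (\<lambda>z. (- 1 / 2) * weighted_norm_sq (matrix_inv R) (z - H *v x)
         - ln (sqrt ((2 * pi) ^ CARD('y) * det R))) y :> - (matrix_inv R *v (y - H *v x))"
    by (rule GDERIV_subst[OF GDERIV_diff[OF GDERIV_mult[OF GDERIV_const GDERIV_weighted_norm_sq[OF sym]]
        GDERIV_const]]) simp
  ultimately show ?thesis
    unfolding lik_score_def by (simp add: grad_eqI)
qed

text \<open>The derivative is a multiple of the identity plus a rank-one map; their traces give the
  dimension term and the inner product.\<close>

lemma divergence_scaleR_diff:
  fixes \<kappa> :: "real^'n \<Rightarrow> real"
  assumes "GDERIV \<kappa> y :> g"
  shows "divergence (\<lambda>z. - (\<kappa> z *\<^sub>R (z - a))) y = - (g \<bullet> (y - a)) - CARD('n) * \<kappa> y"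
proof -
  have "((\<lambda>z. - (\<kappa> z *\<^sub>R (z - a))) has_derivative (\<lambda>h. - (\<kappa> y *\<^sub>R h + (h \<bullet> g) *\<^sub>R (y - a)))) (at y)"
    using assms unfolding gderiv_def by (auto intro!: derivative_eq_intros)
  then have "jacobian (\<lambda>z. - (\<kappa> z *\<^sub>R (z - a))) (at y)
      = matrix (\<lambda>h. - (\<kappa> y *\<^sub>R h + (h \<bullet> g) *\<^sub>R (y - a)))"
    by (simp add: jacobian_def frechet_derivative_at[symmetric])
  then show ?thesis
    by (simp add: divergence_def trace_def matrix_def inner_axis' sum.distrib sum_negf sum_subtractf
        inner_vec_def[of g])
qed

text \<open>The choice of diffusion matrix makes \<open>w ** transpose w\<close> a multiple of
  \<open>R\<close>, which cancels the inverse of \<open>R\<close> in the score. The field under the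
  divergence is then just a scalar multiple of the residual.\<close>

lemma dsm_loss_gaussian:
  fixes R :: "real^'y^'y" and H :: "real^'x^'y" and w :: "real^'y \<Rightarrow> real^'y^'y"
    and \<kappa> :: "real^'y \<Rightarrow> real"
  assumes R: "sym_pd R" and w: "\<And>z. w z = \<kappa> z *\<^sub>R matrix_sqrt R"
    and g: "GDERIV (\<lambda>z. (\<kappa> z)\<^sup>2) y :> g"
  shows "dsm_loss w (lik_score H R) x y
       = (\<kappa> y)\<^sup>2 * weighted_norm_sq (matrix_inv R) (y - H *v x) - 2 * (g \<bullet> (y - H *v x))
         - 2 * CARD('y) * (\<kappa> y)\<^sup>2"
proof -
  let ?r = "matrix_sqrt R"
  have r: "transpose ?r = ?r" "?r ** ?r = R"
    using matrix_sqrt_works[OF R] by (auto simp: sym_psd_def)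
  have ww: "w z ** transpose (w z) = (\<kappa> z)\<^sup>2 *\<^sub>R R" for z
    by (simp add: w transpose_scalar r matrix_scalar_ac scalar_matrix_assoc[symmetric] power2_eq_square)
  have wws: "(w z ** transpose (w z)) *v lik_score H R x z = - ((\<kappa> z)\<^sup>2 *\<^sub>R (z - H *v x))" for z
    using matrix_vector_mult_scaleR[of R "-1"]
    by (simp add: ww lik_score_eq[OF R] scaleR_matrix_vector_assoc[symmetric]
        matrix_vector_mul_assoc sym_pd_inverse[OF R]) (simp add: scaleR_diff_right)
  have "(norm (transpose (w y) *v lik_score H R x y))\<^sup>2
      = (\<kappa> y)\<^sup>2 * weighted_norm_sq (matrix_inv R) (y - H *v x)"
  proof -
    let ?s = "lik_score H R x y"
    have "(norm (transpose (w y) *v ?s))\<^sup>2 = ?s \<bullet> ((w y ** transpose (w y)) *v ?s)"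
      unfolding power2_norm_eq_inner by (metis inner_matrix_vector_transpose matrix_vector_mul_assoc)
    also have "\<dots> = (\<kappa> y)\<^sup>2 * weighted_norm_sq (matrix_inv R) (y - H *v x)"
      unfolding wws by (simp add: lik_score_eq[OF R] weighted_norm_sq_def inner_commute)
    finally show ?thesis .
  qed
  then show ?thesis
    by (simp add: dsm_loss_def wws divergence_scaleR_diff[OF g])
qed

lemma matrix_inv_scaleR:
  assumes "sym_pd S" "c \<noteq> 0"
  shows "matrix_inv (c *\<^sub>R S) = (1 / c) *\<^sub>R matrix_inv S"
  using assms by (intro matrix_inv_eqI)
    (simp add: matrix_scalar_ac scalar_matrix_assoc[symmetric] sym_pd_inverse)

text \<open>The scaling of \<open>N\<close> is chosen so that half its weighted norm reproduces the
  quadratic part of the loss. Shifting the observation by \<open>2 *\<^sub>R (N *v g)\<close>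
  absorbs the linear part, and what is left over does not involve \<open>x\<close>.\<close>

lemma dsm_loss_completed_square:
  fixes R :: "real^'y^'y" and H :: "real^'x^'y" and w :: "real^'y \<Rightarrow> real^'y^'y"
    and \<kappa> :: "real^'y \<Rightarrow> real"
  assumes R: "sym_pd R" and w: "\<And>z. w z = \<kappa> z *\<^sub>R matrix_sqrt R"
    and g: "GDERIV (\<lambda>z. (\<kappa> z)\<^sup>2) y :> g" and \<kappa>: "\<kappa> y \<noteq> 0"
  defines "N \<equiv> (1 / (2 * (\<kappa> y)\<^sup>2)) *\<^sub>R R"
  shows "dsm_loss w (lik_score H R) x y
       = weighted_norm_sq (matrix_inv N) (y - 2 *\<^sub>R (N *v g) - H *v x) / 2
         - 2 * (g \<bullet> (N *v g)) - 2 * CARD('y) * (\<kappa> y)\<^sup>2"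
proof -
  have N: "sym_pd N"
    unfolding N_def using R \<kappa> by (intro sym_pd_scaleR) auto
  have sym: "transpose (matrix_inv N) = matrix_inv N"
    using sym_pd_matrix_inv[OF N] by (simp add: sym_pd_def)
  have inv: "matrix_inv N = (2 * (\<kappa> y)\<^sup>2) *\<^sub>R matrix_inv R"
    using R \<kappa> by (simp add: N_def matrix_inv_scaleR)
  let ?e = "y - H *v x"
  have "y - 2 *\<^sub>R (N *v g) - H *v x = ?e - 2 *\<^sub>R (N *v g)"
    by simp
  then have "weighted_norm_sq (matrix_inv N) (y - 2 *\<^sub>R (N *v g) - H *v x)
      = weighted_norm_sq (matrix_inv N) ?e - 4 * (?e \<bullet> g) + 4 * (g \<bullet> (N *v g))"
    by (simp only: weighted_norm_sq_diff[OF sym])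
      (simp add: weighted_norm_sq_def matrix_vector_mult_scaleR matrix_vector_mul_assoc
        sym_pd_inverse[OF N] inner_commute)
  moreover have "weighted_norm_sq (matrix_inv N) ?e = 2 * (\<kappa> y)\<^sup>2 * weighted_norm_sq (matrix_inv R) ?e"
    by (simp add: inv weighted_norm_sq_def scaleR_matrix_vector_assoc[symmetric])
  ultimately show ?thesis
    by (simp add: dsm_loss_gaussian[OF R w g] inner_commute diff_divide_distrib add_divide_distrib)
qed

text \<open>Squaring removes the fractional power: \<open>(k z)\<^sup>2\<close> is the reciprocal of
  a quadratic polynomial bounded below by 1, hence differentiable everywhere.\<close>

lemma GDERIV_power2_kernel:
  fixes B :: "real^'n^'n"
  assumes B: "sym_pd B" and q: "q\<^sup>2 > 0"
    and k: "\<And>z. k z = (1 + weighted_norm_sq B (z - a) / q\<^sup>2) powr (- 1 / 2)"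
  shows "k y > 0" and "\<exists>g. GDERIV (\<lambda>z. (k z)\<^sup>2) y :> g"
proof -
  define b where "b z = 1 + inverse (q\<^sup>2) * weighted_norm_sq B (z - a)" for z
  have b: "b z > 0" for z
    using q weighted_norm_sq_nonneg[OF B, of "z - a"] by (simp add: b_def add_pos_nonneg)
  have k_b: "k z = b z powr (- 1 / 2)" for z
    unfolding k b_def by (simp only: divide_inverse mult.commute)
  show "k y > 0"
    using b[of y] by (simp add: k_b)
  have "(k z)\<^sup>2 = inverse (b z)" for z
  proof -
    have "(k z)\<^sup>2 = b z powr (- 1)"
      by (simp add: k_b power2_eq_square flip: powr_add)
    then show ?thesis
      using b[of z] by (simp add: powr_minus)
  qed
  moreover have "transpose B = B"
    using B by (simp add: sym_pd_def)
  then have "\<exists>g. GDERIV b y :> g"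
    unfolding b_def
    using GDERIV_add[OF GDERIV_const GDERIV_mult[OF GDERIV_const GDERIV_weighted_norm_sq[of B a y]]]
    by blast
  ultimately show "\<exists>g. GDERIV (\<lambda>z. (k z)\<^sup>2) y :> g"
    using GDERIV_inverse[of b y] b[of y] by auto
qed

section \<open>Gaussian form of the filter, by induction on time\<close>

theorem corollary3:
  fixes M :: "'w measure"
    and X W :: "nat \<Rightarrow> 'w \<Rightarrow> real^'x"
    and Y V :: "nat \<Rightarrow> 'w \<Rightarrow> real^'y"
    and A Q :: "nat \<Rightarrow> real^'x^'x"
    and H :: "nat \<Rightarrow> real^'x^'y"
    and R :: "nat \<Rightarrow> real^'y^'y"
    and m0 :: "real^'x" and P0 :: "real^'x^'x"
    and q :: real
    and y :: "nat \<Rightarrow> real^'y"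
    and \<pi> :: "nat \<Rightarrow> real^'y \<Rightarrow> real"
    and mf ma :: "nat \<Rightarrow> real^'x"
    and Pf Pa :: "nat \<Rightarrow> real^'x^'x"
    and \<Sigma> :: "nat \<Rightarrow> real^'y^'y"
    and k :: "nat \<Rightarrow> real^'y \<Rightarrow> real"
    and w N :: "nat \<Rightarrow> real^'y \<Rightarrow> real^'y^'y"
    and y' :: "nat \<Rightarrow> real^'y"
    and K :: "nat \<Rightarrow> real^'y \<Rightarrow> real^'y^'x"
    and pf pdsm :: "nat \<Rightarrow> real^'x \<Rightarrow> real"
    and py :: "nat \<Rightarrow> real^'y \<Rightarrow> real"
  assumes P0: "sym_pd P0"
    and Q: "\<And>n. n \<ge> 1 \<Longrightarrow> sym_pd (Q n)"
    and R: "\<And>n. n \<ge> 1 \<Longrightarrow> sym_pd (R n)"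
    and system: "linear_gaussian_system M X Y W V A H Q R m0 P0"
    and q: "q\<^sup>2 > 0"
    (* parameter recursion *)
    and ma_0: "ma 0 = m0"
    and Pa_0: "Pa 0 = P0"
    and Pf: "\<And>n. n \<ge> 1 \<Longrightarrow> Pf n = A n ** Pa (n - 1) ** transpose (A n) + Q n"
    and mf: "\<And>n. n \<ge> 1 \<Longrightarrow> mf n = A n *v ma (n - 1)"
    and \<Sigma>: "\<And>n. n \<ge> 1 \<Longrightarrow> \<Sigma> n = H n ** Pf n ** transpose (H n) + R n"
    and k: "\<And>n z. n \<ge> 1 \<Longrightarrow>
          k n z = (1 + weighted_norm_sq (matrix_inv (\<Sigma> n)) (z - H n *v mf n) / q\<^sup>2) powr (- 1 / 2)"
    and N: "\<And>n z. n \<ge> 1 \<Longrightarrow> N n z = (1 / (2 * (k n z)\<^sup>2)) *\<^sub>R R n"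
    and y': "\<And>n. n \<ge> 1 \<Longrightarrow>
          y' n = y n - 2 *\<^sub>R (N n (y n) *v grad (\<lambda>z. (k n z)\<^sup>2) (y n))"
    and K: "\<And>n z. n \<ge> 1 \<Longrightarrow>
          K n z = Pf n ** transpose (H n) ** matrix_inv (N n z + H n ** Pf n ** transpose (H n))"
    and Pa: "\<And>n. n \<ge> 1 \<Longrightarrow> Pa n = Pf n - K n (y n) ** H n ** Pf n"
    and ma: "\<And>n. n \<ge> 1 \<Longrightarrow> ma n = mf n - K n (y n) *v (H n *v mf n - y' n)"
    (* diffusion matrix and true data generating densities *)
    and w: "\<And>n z. n \<ge> 1 \<Longrightarrow> w n z = k n z *\<^sub>R matrix_sqrt (R n)"
    and \<pi>: "\<And>n. n \<ge> 1 \<Longrightarrow> prob_density (\<pi> n)"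
    and regular: "\<And>n. n \<ge> 1 \<Longrightarrow> dsm_regular (\<pi> n) (w n) (lik_score (H n) (R n))"
    (* filtering equations *)
    and pdsm_0: "\<And>x. pdsm 0 x = gauss_density m0 P0 x"
    and pf: "\<And>n x. n \<ge> 1 \<Longrightarrow>
          pf n x = (\<integral>x'. gauss_density (A n *v x') (Q n) x * pdsm (n - 1) x' \<partial>lborel)"
    and py: "\<And>n z. n \<ge> 1 \<Longrightarrow>
          py n z = (\<integral>x. gauss_density (H n *v x) (R n) z * pf n x \<partial>lborel)"
    and pdsm: "\<And>n x. n \<ge> 1 \<Longrightarrow>
          pdsm n x = pf n x * exp (- dsm_loss (w n) (lik_score (H n) (R n)) x (y n)) /
            (\<integral>x'. pf n x' * exp (- dsm_loss (w n) (lik_score (H n) (R n)) x' (y n)) \<partial>lborel)"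
  shows "\<forall>n\<ge>1.
           sym_pd (Pf n) \<and> (\<forall>x. pf n x = gauss_density (mf n) (Pf n) x) \<and>
           sym_pd (\<Sigma> n) \<and> (\<forall>z. py n z = gauss_density (H n *v mf n) (\<Sigma> n) z) \<and>
           sym_pd (Pa n) \<and> (\<forall>x. pdsm n x = gauss_density (ma n) (Pa n) x)"
proof -
  \<comment> \<open>One forecast and analysis cycle, starting from a Gaussian filtering density at
    time \<open>n - 1\<close>.\<close>
  have step: "sym_pd (Pf n) \<and> (\<forall>x. pf n x = gauss_density (mf n) (Pf n) x) \<and>
      sym_pd (\<Sigma> n) \<and> (\<forall>z. py n z = gauss_density (H n *v mf n) (\<Sigma> n) z) \<and>
      sym_pd (Pa n) \<and> (\<forall>x. pdsm n x = gauss_density (ma n) (Pa n) x)"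
    if n: "n \<ge> 1" and P: "sym_pd (Pa (n - 1))"
      and p: "\<And>x. pdsm (n - 1) x = gauss_density (ma (n - 1)) (Pa (n - 1)) x" for n
  proof -
    have Pf': "sym_pd (Pf n)"
      unfolding Pf[OF n] by (intro sym_pd_congruence_add P Q n)
    have pf': "pf n x = gauss_density (mf n) (Pf n) x" for x
      by (simp only: pf[OF n] p integral_gauss_density_mult[OF P Q[OF n]] mf[OF n] Pf[OF n])
    have \<Sigma>': "sym_pd (\<Sigma> n)"
      unfolding \<Sigma>[OF n] by (intro sym_pd_congruence_add Pf' R n)
    have py': "py n z = gauss_density (H n *v mf n) (\<Sigma> n) z" for z
      by (simp add: py[OF n] pf' integral_gauss_density_mult[OF Pf' R[OF n]] \<Sigma>[OF n])
    note kernel = GDERIV_power2_kernel[OF sym_pd_matrix_inv[OF \<Sigma>'] q k[OF n]]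
    have k0: "k n (y n) > 0"
      by (rule kernel)
    obtain g where g: "GDERIV (\<lambda>z. (k n z)\<^sup>2) (y n) :> g"
      using kernel(2) by blast
    define N' where "N' = N n (y n)"
    have N': "sym_pd N'"
      unfolding N'_def N[OF n] using k0 by (intro sym_pd_scaleR R n) simp
    have y'': "y' n = y n - 2 *\<^sub>R (N' *v g)"
      by (simp add: y'[OF n] grad_eqI[OF g] N'_def)
    \<comment> \<open>All terms of the loss that do not depend on the state.\<close>
    define c where "c = 2 * (g \<bullet> (N' *v g)) + 2 * CARD('y) * (k n (y n))\<^sup>2"
    have loss: "dsm_loss (w n) (lik_score (H n) (R n)) x (y n)
        = weighted_norm_sq (matrix_inv N') (y' n - H n *v x) / 2 - c" for x
      using dsm_loss_completed_square[OF R[OF n] w[OF n] g, of "H n" x] k0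
      by (simp add: y'' N'_def N[OF n] c_def)
    \<comment> \<open>The exponential of the negative loss lacks the Gaussian normalizer of
      covariance \<open>N'\<close>; \<open>C\<close> supplies it together with
      \<open>exp c\<close>.\<close>
    define C where "C = exp c * sqrt ((2 * pi) ^ CARD('y) * det N')"
    have C: "C > 0"
      using sym_pd_det_pos[OF N'] by (simp add: C_def)
    have lik: "exp (- dsm_loss (w n) (lik_score (H n) (R n)) x (y n)) = C * gauss_density (H n *v x) N' (y' n)" for x
      using sym_pd_det_pos[OF N']
      by (simp add: loss C_def gauss_density_def flip: exp_add)
    \<comment> \<open>\<open>C\<close> times the evidence of the pseudo-observation
      \<open>y' n\<close>. It turns out to be the integral in the denominator of
      \<open>pdsm\<close>, and being positive it cancels.\<close>
    define D where "D = C * gauss_density (H n *v mf n) (H n ** Pf n ** transpose (H n) + N') (y' n)"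
    have D: "D > 0"
      unfolding D_def by (intro mult_pos_pos C gauss_density_pos sym_pd_congruence_add Pf' N')
    have K': "K n (y n) = Pf n ** transpose (H n) ** matrix_inv (H n ** Pf n ** transpose (H n) + N')"
      by (simp add: K[OF n] N'_def add.commute)
    have ma': "ma n = mf n + K n (y n) *v (y' n - H n *v mf n)"
      by (simp add: ma[OF n] matrix_vector_mult_diff_distrib)
    have Pa': "sym_pd (Pa n)"
      unfolding Pa[OF n] K' by (rule sym_pd_posterior_covariance[OF Pf' N'])
    have post: "pf n x * exp (- dsm_loss (w n) (lik_score (H n) (R n)) x (y n))
        = D * gauss_density (ma n) (Pa n) x" for x
      using gauss_density_mult[OF Pf' N', of "H n" x "y' n" "mf n"]
      by (simp add: pf' lik D_def ma' Pa[OF n] K' mult.left_commute mult.commute)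
    have "pdsm n x = gauss_density (ma n) (Pa n) x" for x
      using D by (simp add: pdsm[OF n] post integral_gauss_density[OF Pa'])
    with Pf' pf' \<Sigma>' py' Pa' show ?thesis
      by blast
  qed
  \<comment> \<open>The induction carries only the analysis claims, since time 0 has a prior but no
    forecast; the remaining claims at \<open>n \<ge> 1\<close> come from \<open>step\<close> applied
    to the invariant at \<open>n - 1\<close>.\<close>
  have "sym_pd (Pa n) \<and> (\<forall>x. pdsm n x = gauss_density (ma n) (Pa n) x)" for n
  proof (induction n)
    case 0
    show ?case
      by (simp add: P0 Pa_0 ma_0 pdsm_0)
  next
    case (Suc n)
    then show ?case
      using step[of "Suc n"] by simp
  qed
  with step show ?thesis
    by blast
qed

end
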